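(* Let $w^*>0$, $w_{12}^*>0$, $T_1\ge0$, and let $\boldsymbol A(T_1)=\boldsymbol B(T_1)=\sqrt{w^*}\,\boldsymbol I_2$. For $t\ge T_1$ let $\boldsymbol A(t),\boldsymbol B(t)\in\mathbb R^{2\times2}$ evolve by gradient flow, started from $(\boldsymbol A(T_1),\boldsymbol B(T_1))$, on the loss $\ell(\boldsymbol A\boldsymbol B;\Omega_{\rm post}^{(2)})$, where $$\ell(\boldsymbol W;\Omega_{\rm post}^{(2)})=\tfrac12\left[(w_{11}-w^* )^2+(w_{12}-w_{12}^* )^2+(w_{22}-w^* )^2\right].$$ Write $\boldsymbol W_{\boldsymbol A,\boldsymbol B}(t)=\boldsymbol A(t)\boldsymbol B(t)$ with entries $w_{ij}(t)$. Then for all $t\ge T_1$, $$\ell(\boldsymbol W_{\boldsymbol A,\boldsymbol B}(t);\Omega_{\rm post}^{(2)})\le\tfrac12{w_{12}^*}^2e^{-2w^*(t-T_1)}.$$ Consequently, the converged matrix $\boldsymbol W_{\boldsymbol A,\boldsymbol B}(\infty)=\lim_{t\to\infty}\boldsymbol W_{\boldsymbol A,\boldsymbol B}(t)$ satisfies $$\mathrm{srank}\big(\boldsymbol W_{\boldsymbol A,\boldsymbol B}(\infty)\big)\ge1+\exp\left(-8\frac{w_{12}^*}{w^*}\right).$$ Furthermore, $w_{21}(t)<0$ for all $t>T_1$.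
   Context: Gradient flow means $\dot{\boldsymbol A}(t)=-\partial_{\boldsymbol A}\,\ell(\boldsymbol A\boldsymbol B;\Omega_{\rm post}^{(2)})$ and $\dot{\boldsymbol B}(t)=-\partial_{\boldsymbol B}\,\ell(\boldsymbol A\boldsymbol B;\Omega_{\rm post}^{(2)})$. Here $\Omega_{\rm post}^{(2)}=\{(1,1),(1,2),(2,2)\}$ is the set of observed entries, with observed values $w_{11}^*=w_{22}^*=w^*$ and $w_{12}^*$. The stable rank is $\mathrm{srank}(\boldsymbol W)=\|\boldsymbol W\|_F^2/\|\boldsymbol W\|_2^2$. (The state at $T_1$ is that reached by pre-training on the diagonal entries only.) *)

theory Defs
  imports "HOL-Analysis.Analysis"
begin

text \<open>The loss \<open>\<ell>(W; \<Omega>)\<close> for \<open>\<Omega> = {(1,1), (1,2), (2,2)}\<close>, with observed values \<open>ws\<close>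
  on the diagonal and \<open>w12\<close> at position (1,2); the entry (2,1) is unobserved.\<close>

definition loss_post :: "real \<Rightarrow> real \<Rightarrow> real ^ 2 ^ 2 \<Rightarrow> real" where
  "loss_post ws w12 W =
     1 / 2 * ((W $ 1 $ 1 - ws)\<^sup>2 + (W $ 1 $ 2 - w12)\<^sup>2 + (W $ 2 $ 2 - ws)\<^sup>2)"

text \<open>Gradient flow on \<open>(A, B) \<mapsto> \<L> (A ** B)\<close> for times \<open>t \<ge> T\<close>. The inner product on
  \<open>real ^ 'n ^ 'm\<close> is the Frobenius one, so \<open>GDERIV\<close> gives the matrix of partial derivatives.
  At the initial time \<open>T\<close> the time derivatives are one-sided.\<close>

definition factor_gradient_flow ::
  "(real ^ 'n ^ 'm \<Rightarrow> real) \<Rightarrow> real \<Rightarrow> (real \<Rightarrow> real ^ 'k ^ 'm) \<Rightarrow> (real \<Rightarrow> real ^ 'n ^ 'k) \<Rightarrow> bool" where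
  "factor_gradient_flow \<L> T A B \<longleftrightarrow>
     (\<forall>t\<ge>T. \<exists>GA GB.
        GDERIV (\<lambda>X. \<L> (X ** B t)) (A t) :> GA \<and>
        GDERIV (\<lambda>Y. \<L> (A t ** Y)) (B t) :> GB \<and>
        (A has_vector_derivative - GA) (at t within {T..}) \<and>
        (B has_vector_derivative - GB) (at t within {T..}))"

text \<open>The library norm on \<open>real ^ 'n ^ 'm\<close> is the Frobenius norm; the spectral norm is the
  operator norm of \<open>x \<mapsto> W *v x\<close> with respect to the Euclidean norms.\<close>

definition stable_rank :: "real ^ 'n ^ 'm \<Rightarrow> real" where
  "stable_rank W = (norm W)\<^sup>2 / (onorm (\<lambda>x. W *v x))\<^sup>2"

end

theory Submission
  imports Defs
begin

text \<open>By the symmetry of the problem the factors have the form \<open>A = (a, b; c, d)\<close> and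
  \<open>B = (d, b; c, a)\<close>. In the coordinates \<open>x = a + b\<close>, \<open>y = a - b\<close>, \<open>z = c + d\<close>, \<open>u = d - c\<close>,
  with residuals \<open>r = w\<^sub>1\<^sub>1 - w\<close> and \<open>s = w\<^sub>1\<^sub>2 - v\<close>, the flow keeps \<open>(u, y) = k (x, z)\<close> where
  \<open>k = exp (\<integral> s)\<close>. The columns of \<open>A\<close> in these coordinates are orthogonal, so \<open>k\<close> is the ratio of
  the singular values of \<open>A\<close> and the stable rank of the product is \<open>1 + k\<^sup>4\<close>.
  The signs \<open>s < 0\<close>, \<open>r > 0\<close>, \<open>k < 1\<close> and \<open>c < 0\<close> persist. They give \<open>a\<^sup>2 \<ge> a d \<ge> w\<close>, and from this
  the exponential decay of the loss; integrating \<open>\<bar>s\<bar> \<le> v exp (- w (t - T))\<close> yields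
  \<open>k \<ge> exp (- v / w)\<close>.\<close>

section \<open>Differential inequalities\<close>

lemma DERIV_within_nonneg_imp_mono:
  fixes f f' :: "real \<Rightarrow> real"
  assumes f: "\<And>t. a \<le> t \<Longrightarrow> (f has_real_derivative f' t) (at t within {a..})"
    and nonneg: "\<And>t. a \<le> t \<Longrightarrow> 0 \<le> f' t" and "a \<le> b"
  shows "f a \<le> f b"
proof (cases "a = b")
  case False
  have "\<exists>t\<in>{a<..<b}. f b - f a = (*) (f' t) (b - a)"
    using False \<open>a \<le> b\<close> f
    by (intro mvt_simple) (auto simp: has_field_derivative_def intro: has_derivative_subset[where s = "{a..}"])
  thus ?thesis
    using nonneg \<open>a \<le> b\<close> by (smt (verit) greaterThanLessThan_iff mult_nonneg_nonneg)
qed simp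

text \<open>This is the mean value theorem for \<open>f t * exp (- G t)\<close>, where
  \<open>G\<close> is an antiderivative of \<open>g\<close>. The sign of \<open>f b\<close> can be
  read off from \<open>f a\<close> and from \<open>f' t - g t * f t\<close> at one interior point,
  so a strict inequality that degenerates at the left endpoint can still be used.\<close>

lemma integrating_factor_mvt:
  fixes f f' g :: "real \<Rightarrow> real"
  assumes "a < b"
    and f: "\<And>t. t \<in> {a..b} \<Longrightarrow> (f has_real_derivative f' t) (at t within {a..b})"
    and g: "continuous_on {a..b} g"
  obtains t p q where "t \<in> {a<..<b}" "p > 0" "q > 0"
    "f b = p * f a + q * (f' t - g t * f t)"
proof -
  obtain G where G: "\<And>t. t \<in> {a..b} \<Longrightarrow> (G has_real_derivative g t) (at t within {a..b})"
    using antiderivative_continuous[OF g] by (auto simp: has_real_derivative_iff_has_vector_derivative)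
  define F where "F t = f t * exp (- G t)" for t
  have F: "(F has_real_derivative (f' t - g t * f t) * exp (- G t)) (at t within {a..b})"
    if "t \<in> {a..b}" for t
    unfolding F_def by (rule derivative_eq_intros f G that refl | simp add: algebra_simps)+
  have "\<exists>t\<in>{a<..<b}. F b - F a = (*) ((f' t - g t * f t) * exp (- G t)) (b - a)"
    using F \<open>a < b\<close> by (intro mvt_simple) (auto simp: has_field_derivative_def)
  then obtain t where t: "t \<in> {a<..<b}"
    "F b - F a = (f' t - g t * f t) * exp (- G t) * (b - a)"
    by auto
  have "f b = F b * exp (G b)"
    by (simp add: F_def exp_minus)
  also have "\<dots> = exp (G b - G a) * f a + exp (G b - G t) * (b - a) * (f' t - g t * f t)"
    using t(2) by (simp add: F_def exp_diff exp_minus field_simps)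
  finally show ?thesis
    using t(1) \<open>a < b\<close> by (intro that) auto
qed

text \<open>A Gronwall argument: the sum of squares of the \<open>f i\<close> grows at a relative
  rate of at most twice the sum of the absolute values of the coefficients, and it starts at
  zero.\<close>

lemma linear_ode_unique_zero:
  fixes f :: "'i \<Rightarrow> real \<Rightarrow> real" and c :: "'i \<Rightarrow> 'i \<Rightarrow> real \<Rightarrow> real"
  assumes "finite I" and "i \<in> I" and "T \<le> t"
    and f: "\<And>i t. i \<in> I \<Longrightarrow> T \<le> t \<Longrightarrow>
      (f i has_real_derivative (\<Sum>j\<in>I. c i j t * f j t)) (at t within {T..})"
    and c: "\<And>i j. i \<in> I \<Longrightarrow> j \<in> I \<Longrightarrow> continuous_on {T..} (c i j)"
    and init: "\<And>i. i \<in> I \<Longrightarrow> f i T = 0"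
  shows "f i t = 0"
proof (cases "T = t")
  case False
  \<comment> \<open>The sum of squares is negated so that the integrating factor gives the lower
    bound \<open>\<Phi> t \<ge> 0\<close>, which squeezes the squares to zero.\<close>
  define \<Phi> where "\<Phi> t = - (\<Sum>i\<in>I. (f i t)\<^sup>2)" for t
  define \<Phi>' where "\<Phi>' t = - (\<Sum>i\<in>I. 2 * f i t * (\<Sum>j\<in>I. c i j t * f j t))" for t
  define g where "g t = (\<Sum>i\<in>I. \<Sum>j\<in>I. 2 * \<bar>c i j t\<bar>)" for t
  have *: "(\<Phi> has_real_derivative \<Phi>' s) (at s within {T..t})" if "s \<in> {T..t}" for s
  proof -
    have "((\<lambda>s. (f i s)\<^sup>2) has_real_derivative 2 * f i s * (\<Sum>j\<in>I. c i j s * f j s)) (at s within {T..t})"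
      if "i \<in> I" for i
    proof (rule DERIV_cong)
      have "(f i has_real_derivative (\<Sum>j\<in>I. c i j s * f j s)) (at s within {T..t})"
        using f[OF \<open>i \<in> I\<close>, of s] \<open>s \<in> {T..t}\<close> by (auto elim: DERIV_subset)
      from DERIV_power[OF this, of 2]
      show "((\<lambda>s. (f i s)\<^sup>2) has_real_derivative of_nat 2 * ((\<Sum>j\<in>I. c i j s * f j s) * f i s ^ (2 - Suc 0)))
          (at s within {T..t})" .
    qed simp
    thus ?thesis
      unfolding \<Phi>_def \<Phi>'_def by (intro DERIV_minus DERIV_sum)
  qed
  have g: "continuous_on {T..t} g"
    unfolding g_def by (intro continuous_intros continuous_on_subset[OF c]) auto
  have "T < t"
    using False \<open>T \<le> t\<close> by simp
  obtain s p q where s: "s \<in> {T<..<t}" "p > 0" "q > 0"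
      "\<Phi> t = p * \<Phi> T + q * (\<Phi>' s - g s * \<Phi> s)"
    by (rule integrating_factor_mvt[OF \<open>T < t\<close> * g])
  have le: "\<bar>f i s\<bar> \<le> sqrt (- \<Phi> s)" if "i \<in> I" for i
    unfolding \<Phi>_def using member_le_sum[of i I "\<lambda>i. (f i s)\<^sup>2"] that \<open>finite I\<close>
    by (auto intro!: real_le_rsqrt)
  have nonpos: "\<Phi> s \<le> 0" for s
    unfolding \<Phi>_def by (auto intro: sum_nonneg)
  have "- \<Phi>' s = (\<Sum>i\<in>I. \<Sum>j\<in>I. 2 * c i j s * (f i s * f j s))"
    unfolding \<Phi>'_def by (simp add: sum_distrib_left mult.assoc mult.left_commute)
  also have "\<dots> \<le> (\<Sum>i\<in>I. \<Sum>j\<in>I. 2 * \<bar>c i j s\<bar> * - \<Phi> s)"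
  proof (intro sum_mono)
    fix i j assume ij: "i \<in> I" "j \<in> I"
    have "\<bar>f i s * f j s\<bar> \<le> sqrt (- \<Phi> s) * sqrt (- \<Phi> s)"
      unfolding abs_mult by (intro mult_mono le ij) (use nonpos[of s] in auto)
    hence "\<bar>f i s * f j s\<bar> \<le> - \<Phi> s"
      using nonpos[of s] by simp
    hence "\<bar>2 * c i j s\<bar> * \<bar>f i s * f j s\<bar> \<le> \<bar>2 * c i j s\<bar> * - \<Phi> s"
      by (intro mult_left_mono) auto
    hence "\<bar>2 * c i j s * (f i s * f j s)\<bar> \<le> 2 * \<bar>c i j s\<bar> * - \<Phi> s"
      by (simp only: abs_mult abs_numeral)
    thus "2 * c i j s * (f i s * f j s) \<le> 2 * \<bar>c i j s\<bar> * - \<Phi> s"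
      by (rule order_trans[OF abs_ge_self])
  qed
  also have "\<dots> = g s * - \<Phi> s"
    unfolding g_def by (simp only: sum_distrib_right)
  finally have "\<Phi>' s - g s * \<Phi> s \<ge> 0"
    by simp
  moreover have "\<Phi> T = 0"
    by (simp add: \<Phi>_def init)
  ultimately have "\<Phi> t \<ge> 0"
    using s by simp
  hence "(\<Sum>i\<in>I. (f i t)\<^sup>2) = 0"
    using nonpos[of t] by (simp add: \<Phi>_def)
  thus ?thesis
    using \<open>finite I\<close> \<open>i \<in> I\<close> by (simp add: sum_nonneg_eq_0_iff)
qed (use init assms(2) in simp)

text \<open>Continuous induction. If \<open>f\<close> became nonnegative, there would be a first
  such time \<open>b\<close>, because the set of these times is closed. The intermediate value
  theorem and minimality then force \<open>f b = 0\<close>, which \<open>step\<close>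
  excludes.\<close>

lemma continuous_on_atLeast_neg:
  fixes f :: "real \<Rightarrow> real"
  assumes cont: "continuous_on {T..} f" and "f T < 0" and "T \<le> t"
    and step: "\<And>b. T < b \<Longrightarrow> (\<And>t. T \<le> t \<Longrightarrow> t < b \<Longrightarrow> f t < 0) \<Longrightarrow> f b \<noteq> 0"
  shows "f t < 0"
proof (rule ccontr)
  assume "\<not> f t < 0"
  define b where "b = Inf {t \<in> {T..}. 0 \<le> f t}"
  have bdd: "bdd_below {t \<in> {T..}. 0 \<le> f t}"
    by (auto intro!: bdd_belowI[of _ T])
  have "b \<in> {t \<in> {T..}. 0 \<le> f t}"
    unfolding b_def using \<open>\<not> f t < 0\<close> \<open>T \<le> t\<close>
    by (intro closed_contains_Inf bdd continuous_closed_preimage_constant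
        continuous_on_closed_Collect_le) (auto intro: cont continuous_intros)
  hence b: "T \<le> b" "0 \<le> f b"
    by auto
  have less: "f t < 0" if "T \<le> t" "t < b" for t
    using that cInf_lower[OF _ bdd, of t] unfolding b_def[symmetric] by force
  have "T < b"
    using b \<open>f T < 0\<close> by (cases "T = b") auto
  have "\<exists>t\<ge>T. t \<le> b \<and> f t = 0"
    using b \<open>f T < 0\<close> by (intro IVT' continuous_on_subset[OF cont]) auto
  then obtain t where "T \<le> t" "t \<le> b" "f t = 0"
    by auto
  with less[of t] have "f b = 0"
    by (cases "t = b") auto
  thus False
    using step[OF \<open>T < b\<close>] less by blast
qed

section \<open>The reduced system\<close>

text \<open>The formulas for \<open>r\<close> and \<open>s\<close> hold at every time, even before
  \<open>T\<close>, so that they can be rewritten as functions under a derivative.\<close>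

locale reduced_flow =
  fixes w v T :: real and x z k r s :: "real \<Rightarrow> real"
  assumes w_pos: "0 < w" and v_pos: "0 < v"
    and k_pos: "T \<le> t \<Longrightarrow> 0 < k t"
    and r_eq: "r t = x t * z t * (1 + (k t)\<^sup>2) / 2 - w"
    and s_eq: "s t = ((x t)\<^sup>2 - (k t)\<^sup>2 * (z t)\<^sup>2) / 2 - v"
    and x_deriv: "T \<le> t \<Longrightarrow> (x has_real_derivative - (r t * z t + s t * x t)) (at t within {T..})"
    and z_deriv: "T \<le> t \<Longrightarrow> (z has_real_derivative - (r t * x t)) (at t within {T..})"
    and k_deriv: "T \<le> t \<Longrightarrow> (k has_real_derivative s t * k t) (at t within {T..})"
    and init: "x T = sqrt w" "z T = sqrt w" "k T = 1"
begin

section \<open>Evolution of the residuals\<close>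

definition r' :: "real \<Rightarrow> real" where
  "r' t = - r t * ((1 + (k t)\<^sup>2) * ((x t)\<^sup>2 + (z t)\<^sup>2) / 2) - s t * (x t * z t * (1 - (k t)\<^sup>2) / 2)"

definition s' :: "real \<Rightarrow> real" where
  "s' t = - s t * ((x t)\<^sup>2 + (k t)\<^sup>2 * (z t)\<^sup>2) - r t * (x t * z t * (1 - (k t)\<^sup>2))"

lemma r_deriv:
  assumes "T \<le> t"
  shows "(r has_real_derivative r' t) (at t within {T..})"
proof -
  have "((\<lambda>t. x t * z t * (1 + (k t)\<^sup>2) / 2 - w) has_real_derivative r' t) (at t within {T..})"
    unfolding r'_def
    by (auto intro!: derivative_eq_intros x_deriv z_deriv k_deriv assms simp: field_simps power2_eq_square)
  thus ?thesis
    unfolding r_eq[symmetric] .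
qed

lemma s_deriv:
  assumes "T \<le> t"
  shows "(s has_real_derivative s' t) (at t within {T..})"
proof -
  have "((\<lambda>t. ((x t)\<^sup>2 - (k t)\<^sup>2 * (z t)\<^sup>2) / 2 - v) has_real_derivative s' t) (at t within {T..})"
    unfolding s'_def
    by (auto intro!: derivative_eq_intros x_deriv z_deriv k_deriv assms simp: field_simps power2_eq_square)
  thus ?thesis
    unfolding s_eq[symmetric] .
qed

lemma continuous:
  "continuous_on {T..} x" "continuous_on {T..} z" "continuous_on {T..} k"
  "continuous_on {T..} r" "continuous_on {T..} s"
  by (auto intro!: DERIV_continuous_on x_deriv z_deriv k_deriv r_deriv s_deriv)

text \<open>This makes \<open>x t * z t\<close> positive as soon as \<open>r t\<close> is
  nonnegative, before anything is known about the signs of \<open>x\<close> and \<open>z\<close>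
  separately.\<close>

lemma xz_eq: "x t * z t = 2 * (r t + w) / (1 + (k t)\<^sup>2)"
proof -
  have "1 + (k t)\<^sup>2 > 0"
    by (simp add: add_pos_nonneg)
  thus ?thesis
    unfolding r_eq by (simp add: field_simps)
qed

section \<open>Persistence of signs\<close>

lemma init_rs: "r T = 0" "s T = - v"
  using w_pos by (simp_all add: r_eq s_eq init)

text \<open>The signs follow from each other in a chain: \<open>s < 0\<close> before
  \<open>b\<close> makes \<open>k\<close> decrease below 1, this pushes \<open>r\<close> above 0,
  and then \<open>s\<close> is still negative at \<open>b\<close>. Hence \<open>s\<close> has no
  first zero.\<close>

lemma sign_step:
  assumes "T < b" and neg: "\<And>t. T \<le> t \<Longrightarrow> t < b \<Longrightarrow> s t < 0"
  shows "k b < 1" "0 < r b" "s b < 0"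
proof -
  have k: "k e < 1" if "T < e" "e \<le> b" for e
  proof (rule integrating_factor_mvt[of T e "\<lambda>t. 1 - k t" "\<lambda>t. - (s t * k t)" "\<lambda>_. 0"])
    show "((\<lambda>t. 1 - k t) has_real_derivative - (s t * k t)) (at t within {T..e})" if "t \<in> {T..e}" for t
      using that by (auto intro!: derivative_eq_intros DERIV_subset[OF k_deriv])
    fix t p q
    assume t: "t \<in> {T<..<e}" and "0 < p" "0 < q" and eq: "1 - k e = p * (1 - k T) + q * (- (s t * k t) - 0 * (1 - k t))"
    have "s t * k t < 0"
      using t \<open>e \<le> b\<close> by (intro mult_neg_pos neg k_pos) auto
    hence "0 < q * (- (s t * k t))"
      using \<open>0 < q\<close> by (intro mult_pos_pos) auto
    thus "k e < 1"
      using eq by (simp add: init)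
  qed (use that in auto)
  \<comment> \<open>After \<open>xz_eq\<close> the \<open>s\<close>-term of \<open>r'\<close>
    contains the factor \<open>r + w\<close>. Its \<open>r\<close> part goes into the integrating
    factor together with the damping. What remains is
    \<open>- s * w * (1 - k\<^sup>2) / (1 + k\<^sup>2)\<close>, which is positive after time
    \<open>T\<close>.\<close>
  have r: "0 < r e" if "T < e" "e \<le> b" for e
  proof (rule integrating_factor_mvt[of T e r r'
        "\<lambda>t. - ((1 + (k t)\<^sup>2) * ((x t)\<^sup>2 + (z t)\<^sup>2) / 2) - s t * ((1 - (k t)\<^sup>2) / (1 + (k t)\<^sup>2))"])
    fix t p q
    assume t: "t \<in> {T<..<e}" and "0 < p" "0 < q" and eq: "r e = p * r T +
       q * (r' t -
       (- ((1 + (k t)\<^sup>2) * ((x t)\<^sup>2 + (z t)\<^sup>2) / 2) - s t * ((1 - (k t)\<^sup>2) / (1 + (k t)\<^sup>2))) * r t)"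
    have "k t < 1" "0 < k t" "s t < 0"
      using k[of t] k_pos[of t] neg[of t] t \<open>e \<le> b\<close> by auto
    hence "(k t)\<^sup>2 < 1"
      by (simp add: power_less_one_iff)
    have *: "2 * a / D * E / 2 = a * (E / D)" for a D E :: real
      by simp
    have **: "q * (- R * P - S * ((R + w) * H) - (- P - S * H) * R) = q * (- S * w * H)" for R P S H
      by (simp add: algebra_simps)
    have K: "x t * z t * (1 - (k t)\<^sup>2) / 2 = (r t + w) * ((1 - (k t)\<^sup>2) / (1 + (k t)\<^sup>2))"
      unfolding xz_eq using * by (simp only:)
    have "r e = q * (- s t * w * ((1 - (k t)\<^sup>2) / (1 + (k t)\<^sup>2)))"
      unfolding eq r'_def K init_rs by (simp only: ** mult_zero_right add_0_left)
    also have "\<dots> > 0"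
      using \<open>0 < q\<close> \<open>s t < 0\<close> \<open>(k t)\<^sup>2 < 1\<close> w_pos
      by (intro mult_pos_pos divide_pos_pos) (auto simp: add_pos_nonneg)
    finally show "0 < r e" .
  next
    show "continuous_on {T..e} (\<lambda>t. - ((1 + (k t)\<^sup>2) * ((x t)\<^sup>2 + (z t)\<^sup>2) / 2) - s t * ((1 - (k t)\<^sup>2) / (1 + (k t)\<^sup>2)))"
      by (intro continuous_intros continuous_on_subset[OF continuous(1)] continuous_on_subset[OF continuous(2)]
          continuous_on_subset[OF continuous(3)] continuous_on_subset[OF continuous(5)]) (auto simp: add_nonneg_eq_0_iff)
  qed (use that in \<open>auto intro!: DERIV_subset[OF r_deriv]\<close>)
  show "k b < 1" "0 < r b"
    using k r \<open>T < b\<close> by auto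
  \<comment> \<open>With the damping of \<open>s\<close> as integrating factor, \<open>- s b\<close>
    is a positive multiple of \<open>v\<close> plus a positive multiple of
    \<open>r * x * z * (1 - k\<^sup>2)\<close>.\<close>
  show "s b < 0"
  proof (rule integrating_factor_mvt[of T b "\<lambda>t. - s t" "\<lambda>t. - s' t"
        "\<lambda>t. - ((x t)\<^sup>2 + (k t)\<^sup>2 * (z t)\<^sup>2)"])
    fix t p q
    assume t: "t \<in> {T<..<b}" and "0 < p" "0 < q" and eq: "- s b = p * (- s T) +
       q * (- s' t -
       (- ((x t)\<^sup>2 + (k t)\<^sup>2 * (z t)\<^sup>2)) * (- s t))"
    have "k t < 1" "0 < k t" "0 < r t"
      using k[of t] k_pos[of t] r[of t] t by auto
    hence "(k t)\<^sup>2 < 1"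
      by (simp add: power_less_one_iff)
    have "- s b = p * v + q * (r t * (x t * z t * (1 - (k t)\<^sup>2)))"
      unfolding eq s'_def by (simp add: init_rs algebra_simps)
    also have "\<dots> > 0"
      unfolding xz_eq using \<open>0 < q\<close> \<open>0 < p\<close> \<open>0 < r t\<close> \<open>0 < k t\<close> \<open>(k t)\<^sup>2 < 1\<close> w_pos v_pos
      by (intro add_pos_pos mult_pos_pos divide_pos_pos) (auto simp: add_pos_nonneg)
    finally show "s b < 0"
      by simp
  next
    show "continuous_on {T..b} (\<lambda>t. - ((x t)\<^sup>2 + (k t)\<^sup>2 * (z t)\<^sup>2))"
      by (intro continuous_intros continuous_on_subset[OF continuous(1)] continuous_on_subset[OF continuous(2)]
          continuous_on_subset[OF continuous(3)]) auto
  qed (use \<open>T < b\<close> in \<open>auto intro!: DERIV_minus DERIV_subset[OF s_deriv]\<close>)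
qed

lemma s_neg:
  assumes "T \<le> t"
  shows "s t < 0"
  using continuous(5) _ assms
proof (rule continuous_on_atLeast_neg)
  show "s T < 0"
    using v_pos by (simp add: init_rs)
  fix b assume "T < b" "\<And>t. T \<le> t \<Longrightarrow> t < b \<Longrightarrow> s t < 0"
  from sign_step(3)[OF this] show "s b \<noteq> 0"
    by simp
qed

lemma k_less_1: "T < t \<Longrightarrow> k t < 1" and r_pos: "T < t \<Longrightarrow> 0 < r t"
  using sign_step[of t] s_neg by auto

lemma k_le_1: "T \<le> t \<Longrightarrow> k t \<le> 1" and r_nonneg: "T \<le> t \<Longrightarrow> 0 \<le> r t"
  using k_less_1[of t] r_pos[of t] init_rs init by (cases "T = t"; simp)+

lemma xz_pos: "T \<le> t \<Longrightarrow> 0 < x t * z t"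
  unfolding xz_eq using r_nonneg[of t] w_pos by (simp add: add_pos_nonneg)

text \<open>Since \<open>x * z\<close> stays positive, \<open>x\<close> cannot vanish and keeps its
  initial sign.\<close>

lemma x_pos:
  assumes "T \<le> t"
  shows "0 < x t"
proof -
  have "- x t < 0"
    using _ _ assms
  proof (rule continuous_on_atLeast_neg)
    fix b assume "T < b"
    thus "- x b \<noteq> 0"
      using xz_pos[of b] by auto
  qed (use continuous w_pos in \<open>auto intro!: continuous_intros simp: init\<close>)
  thus ?thesis by simp
qed

lemma z_pos: "T \<le> t \<Longrightarrow> 0 < z t"
  using xz_pos[of t] x_pos[of t] by (simp add: zero_less_mult_iff)

text \<open>This is the sign \<open>c < 0\<close>. The terms with \<open>s\<close> cancel in the
  derivative of \<open>k * x - z\<close>, and with \<open>r\<close> as integrating factor there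
  remains \<open>r * (1 - k) * (x + z) > 0\<close>.\<close>

lemma z_less_kx:
  assumes "T < t"
  shows "z t < k t * x t"
proof (rule integrating_factor_mvt[of T t "\<lambda>t. k t * x t - z t" "\<lambda>t. r t * (x t - k t * z t)" r])
  show "((\<lambda>t. k t * x t - z t) has_real_derivative r e * (x e - k e * z e)) (at e within {T..t})"
    if "e \<in> {T..t}" for e
    using that by - (rule DERIV_subset[of _ _ _ "{T..}"],
      auto intro!: derivative_eq_intros x_deriv z_deriv k_deriv simp: algebra_simps)
  fix e p q
  assume e: "e \<in> {T<..<t}" and "0 < p" "0 < q" and eq: "k t * x t - z t = p * (k T * x T - z T) +
    q * (r e * (x e - k e * z e) - r e * (k e * x e - z e))"
  have "k t * x t - z t = q * (r e * ((1 - k e) * (x e + z e)))"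
    unfolding eq by (simp add: init algebra_simps)
  also have "\<dots> > 0"
    using e \<open>0 < q\<close> r_pos[of e] k_less_1[of e] x_pos[of e] z_pos[of e] by simp
  finally show "z t < k t * x t"
    by simp
qed (use assms in \<open>auto intro: continuous_on_subset[OF continuous(4)]\<close>)

lemma z_le_kx: "T \<le> t \<Longrightarrow> z t \<le> k t * x t"
  using z_less_kx[of t] init by (cases "T = t") auto

lemma z_le_x: "T \<le> t \<Longrightarrow> z t \<le> x t"
  by (rule order_trans[OF z_le_kx mult_left_le_one_le]) (auto intro: less_imp_le x_pos k_pos k_le_1)

text \<open>In terms of the entries \<open>a, b, c, d\<close> of the first factor, the negative rate of change of the
  loss is \<open>2 ((r d + s b)\<^sup>2 + (r c + s a)\<^sup>2 + r\<^sup>2 (a\<^sup>2 + b\<^sup>2))\<close>, where \<open>r c\<close> and \<open>s a\<close> have the same sign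
  and \<open>a\<^sup>2 \<ge> a d \<ge> w\<close>.\<close>
lemma loss_bound:
  assumes "T \<le> t"
  shows "(r t)\<^sup>2 + (s t)\<^sup>2 / 2 \<le> v\<^sup>2 / 2 * exp (- 2 * w * (t - T))"
proof -
  have decay: "2 * r t * r' t + s t * s' t \<le> - (2 * w) * ((r t)\<^sup>2 + (s t)\<^sup>2 / 2)" if t: "T \<le> t" for t
  proof -
    define a b c d where "a = (x t + k t * z t) / 2" and "b = (x t - k t * z t) / 2"
      and "c = (z t - k t * x t) / 2" and "d = (z t + k t * x t) / 2"
    note pos = k_pos[OF t] x_pos[OF t] z_pos[OF t] r_nonneg[OF t]
    have eq: "2 * r t * r' t + s t * s' t =
        - 2 * ((r t * d + s t * b)\<^sup>2 + (r t * c + s t * a)\<^sup>2 + (r t)\<^sup>2 * (a\<^sup>2 + b\<^sup>2))"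
      unfolding r'_def s'_def a_def b_def c_def d_def by (simp add: field_simps power2_eq_square)
    have "c \<le> 0" "0 < a" "0 < d"
      using z_le_kx[OF t] pos by (auto simp: a_def c_def d_def add_pos_pos)
    have "a - d = (x t - z t) * (1 - k t) / 2" and "b = - c + (x t + z t) * (1 - k t) / 2"
      unfolding a_def b_def c_def d_def by (simp_all add: field_simps)
    hence "d \<le> a" "0 \<le> b"
      using z_le_x[OF t] k_le_1[OF t] pos \<open>c \<le> 0\<close>
      by (smt (verit) mult_nonneg_nonneg divide_nonneg_pos)+
    \<comment> \<open>The left side is the (1,1) entry of the product. It is at least
      \<open>w\<close> and \<open>b * c\<close> is nonpositive, so \<open>a * d\<close> alone is at
      least \<open>w\<close>.\<close>
    have "a * d + b * c = r t + w"
      unfolding r_eq a_def b_def c_def d_def by (simp add: field_simps power2_eq_square)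
    moreover have "b * c \<le> 0"
      using \<open>0 \<le> b\<close> \<open>c \<le> 0\<close> by (rule mult_nonneg_nonpos)
    moreover have "a * d \<le> a\<^sup>2"
      using \<open>d \<le> a\<close> \<open>0 < a\<close> by (simp add: power2_eq_square)
    ultimately have "w \<le> a\<^sup>2"
      using pos by linarith
    have "0 \<le> (r t * c) * (s t * a)"
      using \<open>c \<le> 0\<close> \<open>0 < a\<close> s_neg[OF t] pos by (intro mult_nonpos_nonpos mult_nonneg_nonpos mult_nonpos_nonneg) auto
    hence "(s t * a)\<^sup>2 \<le> (r t * c + s t * a)\<^sup>2"
      using power2_sum[of "r t * c" "s t * a"] zero_le_power2[of "r t * c"] by linarith
    hence 1: "(s t)\<^sup>2 * a\<^sup>2 \<le> (r t * c + s t * a)\<^sup>2"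
      by (simp only: power_mult_distrib)
    have 2: "(s t)\<^sup>2 * w \<le> (s t)\<^sup>2 * a\<^sup>2"
      using \<open>w \<le> a\<^sup>2\<close> by (rule mult_left_mono) simp
    have 3: "(r t)\<^sup>2 * w \<le> (r t)\<^sup>2 * (a\<^sup>2 + b\<^sup>2)"
      using \<open>w \<le> a\<^sup>2\<close> by (intro mult_left_mono add_increasing2) auto
    have 4: "0 \<le> (r t * d + s t * b)\<^sup>2" "0 \<le> (s t)\<^sup>2 * w"
      using w_pos by auto
    have *: "- 2 * (P + Q + R) \<le> - (2 * X + Y)"
      if "Y \<le> S" "S \<le> Q" "X \<le> R" "0 \<le> P" "0 \<le> Y" for X Y P Q R S :: real
      using that by argo
    have "2 * r t * r' t + s t * s' t \<le> - (2 * ((r t)\<^sup>2 * w) + (s t)\<^sup>2 * w)"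
      unfolding eq by (rule *[OF 2 1 3 4])
    also have "\<dots> = - (2 * w) * ((r t)\<^sup>2 + (s t)\<^sup>2 / 2)"
      by (simp add: field_simps)
    finally show ?thesis .
  qed
  \<comment> \<open>The loss is compensated by its expected decay and negated, because the
    monotonicity lemma is about nondecreasing functions.\<close>
  define \<phi> where "\<phi> t = - (((r t)\<^sup>2 + (s t)\<^sup>2 / 2) * exp (2 * w * (t - T)))" for t
  have "\<phi> T \<le> \<phi> t"
  proof (rule DERIV_within_nonneg_imp_mono[OF _ _ \<open>T \<le> t\<close>])
    show "(\<phi> has_real_derivative
        - (2 * r t * r' t + s t * s' t + 2 * w * ((r t)\<^sup>2 + (s t)\<^sup>2 / 2)) * exp (2 * w * (t - T)))
        (at t within {T..})" if "T \<le> t" for t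
      unfolding \<phi>_def using that by (auto intro!: derivative_eq_intros r_deriv s_deriv simp: algebra_simps)
    show "0 \<le> - (2 * r t * r' t + s t * s' t + 2 * w * ((r t)\<^sup>2 + (s t)\<^sup>2 / 2)) * exp (2 * w * (t - T))"
      if "T \<le> t" for t
      using decay[OF that] by (intro mult_nonneg_nonneg) auto
  qed
  hence "((r t)\<^sup>2 + (s t)\<^sup>2 / 2) * exp (2 * w * (t - T)) \<le> v\<^sup>2 / 2"
    by (simp add: \<phi>_def init_rs)
  hence "(r t)\<^sup>2 + (s t)\<^sup>2 / 2 \<le> v\<^sup>2 / 2 / exp (2 * w * (t - T))"
    by (subst pos_le_divide_eq) auto
  moreover have "exp (- 2 * w * (t - T)) = inverse (exp (2 * w * (t - T)))"
    by (simp flip: exp_minus)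
  ultimately show ?thesis
    by (simp only: divide_inverse)
qed

section \<open>Consequences of the decay for the ratio and the residuals\<close>

lemma s_ge:
  assumes "T \<le> t"
  shows "- v * exp (- w * (t - T)) \<le> s t"
proof -
  have "(s t)\<^sup>2 / 2 \<le> v\<^sup>2 / 2 * exp (- 2 * w * (t - T))"
    using loss_bound[OF assms] by (smt (verit) zero_le_power2)
  also have "\<dots> = (v * exp (- w * (t - T)))\<^sup>2 / 2"
    by (simp add: power_mult_distrib flip: exp_double)
  finally have "(s t)\<^sup>2 \<le> (v * exp (- w * (t - T)))\<^sup>2"
    by linarith
  hence "\<bar>s t\<bar> \<le> \<bar>v * exp (- w * (t - T))\<bar>"
    by (simp only: abs_le_square_iff)
  also have "\<dots> = v * exp (- w * (t - T))"
    using v_pos by (intro abs_of_nonneg) simp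
  finally have "- (v * exp (- w * (t - T))) \<le> s t"
    by (simp only: abs_le_iff) linarith
  thus ?thesis
    by simp
qed

text \<open>The derivative of \<open>ln k\<close> is \<open>s\<close>, and \<open>v / w\<close> is
  the integral of the bound \<open>v * exp (- w * (t - T))\<close> from \<open>T\<close> to
  infinity.\<close>

lemma k_ge:
  assumes "T \<le> t"
  shows "exp (- (v / w)) \<le> k t"
proof -
  define f where "f t = ln (k t) - v / w * exp (- w * (t - T))" for t
  have "f T \<le> f t"
  proof (rule DERIV_within_nonneg_imp_mono[OF _ _ assms])
    show "(f has_real_derivative s t + v * exp (- w * (t - T))) (at t within {T..})" if "T \<le> t" for t
      unfolding f_def using that k_pos[OF that] w_pos
      by (auto intro!: derivative_eq_intros k_deriv simp: field_simps)
    show "0 \<le> s t + v * exp (- w * (t - T))" if "T \<le> t" for t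
      using s_ge[OF that] by simp
  qed
  moreover have "0 \<le> v / w * exp (- w * (t - T))"
    using v_pos w_pos by simp
  ultimately have "- (v / w) \<le> ln (k t)"
    by (simp add: f_def init)
  thus ?thesis
    using k_pos[OF assms] by (simp add: ln_ge_iff)
qed

lemma r_s_tendsto_0: "(r \<longlongrightarrow> 0) at_top" "(s \<longlongrightarrow> 0) at_top"
proof -
  have "filterlim (\<lambda>t. - 2 * w * (t - T)) at_bot at_top"
    using w_pos filterlim_tendsto_add_at_top[OF tendsto_const[of "- T"] filterlim_ident]
    by (intro filterlim_tendsto_neg_mult_at_bot[OF tendsto_const]) simp_all
  hence "((\<lambda>t. v\<^sup>2 * exp (- 2 * w * (t - T))) \<longlongrightarrow> v\<^sup>2 * 0) at_top"
    by (intro tendsto_mult tendsto_const filterlim_compose[OF exp_at_bot])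
  hence lim: "((\<lambda>t. sqrt (v\<^sup>2 * exp (- 2 * w * (t - T)))) \<longlongrightarrow> 0) at_top"
    using tendsto_real_sqrt by fastforce
  have "(r t)\<^sup>2 \<le> v\<^sup>2 * exp (- 2 * w * (t - T))" "(s t)\<^sup>2 \<le> v\<^sup>2 * exp (- 2 * w * (t - T))" if "T \<le> t" for t
  proof -
    have "0 \<le> v\<^sup>2 / 2 * exp (- 2 * w * (t - T))" "0 \<le> (r t)\<^sup>2" "0 \<le> (s t)\<^sup>2"
      by auto
    thus "(r t)\<^sup>2 \<le> v\<^sup>2 * exp (- 2 * w * (t - T))" "(s t)\<^sup>2 \<le> v\<^sup>2 * exp (- 2 * w * (t - T))"
      using loss_bound[OF that] by linarith+
  qed
  hence "\<bar>r t\<bar> \<le> sqrt (v\<^sup>2 * exp (- 2 * w * (t - T)))" "\<bar>s t\<bar> \<le> sqrt (v\<^sup>2 * exp (- 2 * w * (t - T)))"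
    if "T \<le> t" for t
    using that by (auto intro!: real_le_rsqrt)
  hence "\<forall>\<^sub>F t in at_top. norm (r t) \<le> sqrt (v\<^sup>2 * exp (- 2 * w * (t - T)))"
        "\<forall>\<^sub>F t in at_top. norm (s t) \<le> sqrt (v\<^sup>2 * exp (- 2 * w * (t - T)))"
    by (auto intro: eventually_at_top_linorderI[of T])
  thus "(r \<longlongrightarrow> 0) at_top" "(s \<longlongrightarrow> 0) at_top"
    using lim by (auto intro: Lim_null_comparison)
qed

section \<open>The unobserved entry\<close>

text \<open>This is \<open>2 * c * d\<close>, the entry (2,1) of the product, in the reduced
  coordinates.\<close>

definition w21 :: "real \<Rightarrow> real" where
  "w21 t = ((z t)\<^sup>2 - (k t)\<^sup>2 * (x t)\<^sup>2) / 2"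

lemma w21_neg:
  assumes "T < t"
  shows "w21 t < 0"
proof -
  have "(z t)\<^sup>2 < (k t * x t)\<^sup>2"
    using z_less_kx[OF assms] z_pos[of t] assms by (intro power_strict_mono) auto
  thus ?thesis
    by (simp add: w21_def power_mult_distrib)
qed

text \<open>The terms with \<open>s\<close> cancel in the derivative, leaving
  \<open>- r * x * z * (1 - k\<^sup>2)\<close>. Together with the lower bound below this yields a
  limit of the product without any claim that the factors converge.\<close>

lemma w21_antimono:
  assumes "T \<le> t" "t \<le> t'"
  shows "w21 t' \<le> w21 t"
proof -
  have "- w21 t \<le> - w21 t'"
  proof (rule DERIV_within_nonneg_imp_mono[OF _ _ \<open>t \<le> t'\<close>])
    fix e assume "t \<le> e"
    hence e: "T \<le> e"
      using \<open>T \<le> t\<close> by simp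
    have "((\<lambda>t. - w21 t) has_real_derivative r e * (x e * z e * (1 - (k e)\<^sup>2))) (at e within {T..})"
      unfolding w21_def using e
      by (auto intro!: derivative_eq_intros x_deriv z_deriv k_deriv simp: field_simps power2_eq_square)
    thus "((\<lambda>t. - w21 t) has_real_derivative r e * (x e * z e * (1 - (k e)\<^sup>2))) (at e within {t..})"
      by (rule DERIV_subset) (use \<open>T \<le> t\<close> in auto)
    show "0 \<le> r e * (x e * z e * (1 - (k e)\<^sup>2))"
      using r_nonneg[OF e] x_pos[OF e] z_pos[OF e] k_le_1[OF e] k_pos[OF e]
      by (intro mult_nonneg_nonneg) (auto simp: power_le_one)
  qed
  thus ?thesis by simp
qed

text \<open>From \<open>- c \<le> b\<close> and \<open>d \<le> a\<close>, the value
  \<open>- 2 * c * d\<close> is at most \<open>2 * a * b\<close>, which is the (1,2) entry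
  \<open>s + v\<close> and thus below \<open>v\<close>.\<close>

lemma w21_ge:
  assumes t: "T \<le> t"
  shows "- v \<le> w21 t"
proof -
  note pos = k_pos[OF t] x_pos[OF t] z_pos[OF t]
  have "- w21 t = (k t * x t - z t) * (z t + k t * x t) / 2"
    by (simp add: w21_def field_simps power2_eq_square)
  also have "\<dots> \<le> (x t - k t * z t) * (x t + k t * z t) / 2"
  proof (intro divide_right_mono mult_mono)
    have "0 \<le> (x t + z t) * (1 - k t)" "0 \<le> (x t - z t) * (1 - k t)"
      using pos k_le_1[OF t] z_le_x[OF t] by auto
    thus "k t * x t - z t \<le> x t - k t * z t" "z t + k t * x t \<le> x t + k t * z t"
      by (simp_all add: algebra_simps)
    thus "0 \<le> x t - k t * z t"
      using z_le_kx[OF t] by linarith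
  qed (use pos in auto)
  also have "\<dots> = s t + v"
    unfolding s_eq by (simp add: field_simps power2_eq_square)
  also have "\<dots> \<le> v"
    using s_neg[OF t] by simp
  finally show ?thesis
    by simp
qed

lemma w21_convergent: "\<exists>l. (w21 \<longlongrightarrow> l) at_top"
proof
  have bdd: "bdd_below (w21 ` {T..})"
    using w21_ge by (intro bdd_belowI2[of _ "- v"]) auto
  show "(w21 \<longlongrightarrow> Inf (w21 ` {T..})) at_top"
  proof (rule decreasing_tendsto)
    show "\<forall>\<^sub>F t in at_top. Inf (w21 ` {T..}) \<le> w21 t"
      using eventually_ge_at_top[of T] by eventually_elim (auto intro: cInf_lower bdd)
    fix y assume "Inf (w21 ` {T..}) < y"
    then obtain e where e: "T \<le> e" "w21 e < y"
      using bdd by (auto simp: cInf_less_iff)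
    show "\<forall>\<^sub>F t in at_top. w21 t < y"
      using eventually_ge_at_top[of e] by eventually_elim (use e w21_antimono in force)
  qed
qed

text \<open>The singular values of the product are \<open>(x\<^sup>2 + z\<^sup>2) / 2\<close> and \<open>k\<^sup>2\<close> times that, so the
  squared Frobenius norm is \<open>1 + k\<^sup>4\<close> times the squared spectral norm.\<close>
lemma spectral_ineq:
  assumes t: "T \<le> t"
  shows "(1 + exp (- (v / w)) ^ 4) *
      (((r t + w) * p + (s t + v) * q)\<^sup>2 + (w21 t * p + (r t + w) * q)\<^sup>2)
    \<le> ((r t + w)\<^sup>2 + (s t + v)\<^sup>2 + (w21 t)\<^sup>2 + (r t + w)\<^sup>2) * (p\<^sup>2 + q\<^sup>2)"
proof -
  define e where "e = ((x t)\<^sup>2 + (z t)\<^sup>2) / 2"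
  define n where "n = ((r t + w) * p + (s t + v) * q)\<^sup>2 + (w21 t * p + (r t + w) * q)\<^sup>2"
  have "0 \<le> n" "0 \<le> e"
    by (auto simp: n_def e_def)
  have frob: "(r t + w)\<^sup>2 + (s t + v)\<^sup>2 + (w21 t)\<^sup>2 + (r t + w)\<^sup>2 = e\<^sup>2 * (1 + k t ^ 4)"
    unfolding r_eq s_eq w21_def e_def by (simp add: field_simps power2_eq_square power4_eq_xxxx)
  \<comment> \<open>The vector \<open>(x, - z)\<close> is a right singular vector for the smaller
    singular value, so the deficit is the difference of the squared singular values times the
    squared component of \<open>(p, q)\<close> along it.\<close>
  have "e\<^sup>2 * (p\<^sup>2 + q\<^sup>2) - n = (1 - k t ^ 4) * e * (x t * p - z t * q)\<^sup>2 / 2"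
    unfolding n_def r_eq s_eq w21_def e_def by (simp add: field_simps power2_eq_square power4_eq_xxxx)
  also have "\<dots> \<ge> 0"
    using k_le_1[OF t] k_pos[OF t] \<open>0 \<le> e\<close> by (auto simp: power_le_one)
  finally have "n \<le> e\<^sup>2 * (p\<^sup>2 + q\<^sup>2)"
    by simp
  moreover have "exp (- (v / w)) ^ 4 \<le> k t ^ 4"
    by (intro power_mono k_ge t) auto
  ultimately have "(1 + exp (- (v / w)) ^ 4) * n \<le> (1 + k t ^ 4) * (e\<^sup>2 * (p\<^sup>2 + q\<^sup>2))"
    using \<open>0 \<le> n\<close> by (intro mult_mono) auto
  thus ?thesis
    unfolding frob n_def by (simp add: mult_ac)
qed

text \<open>For each fixed vector \<open>(p, q)\<close> both sides are polynomials in the entries,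
  so the inequality passes to the limit with no appeal to continuity of the stable rank.\<close>

lemma spectral_ineq_limit:
  assumes "(w21 \<longlongrightarrow> l) at_top"
  shows "(1 + exp (- (v / w)) ^ 4) * ((w * p + v * q)\<^sup>2 + (l * p + w * q)\<^sup>2)
    \<le> (w\<^sup>2 + v\<^sup>2 + l\<^sup>2 + w\<^sup>2) * (p\<^sup>2 + q\<^sup>2)"
proof (rule tendsto_le)
  note lims = tendsto_add[OF r_s_tendsto_0(1) tendsto_const[of w], unfolded add_0_left] tendsto_add[OF r_s_tendsto_0(2) tendsto_const[of v], unfolded add_0_left] assms
  show "((\<lambda>t. (1 + exp (- (v / w)) ^ 4) *
      (((r t + w) * p + (s t + v) * q)\<^sup>2 + (w21 t * p + (r t + w) * q)\<^sup>2)) \<longlongrightarrow>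
      (1 + exp (- (v / w)) ^ 4) * ((w * p + v * q)\<^sup>2 + (l * p + w * q)\<^sup>2)) at_top"
    by (intro tendsto_intros lims)
  show "((\<lambda>t. ((r t + w)\<^sup>2 + (s t + v)\<^sup>2 + (w21 t)\<^sup>2 + (r t + w)\<^sup>2) * (p\<^sup>2 + q\<^sup>2)) \<longlongrightarrow>
      (w\<^sup>2 + v\<^sup>2 + l\<^sup>2 + w\<^sup>2) * (p\<^sup>2 + q\<^sup>2)) at_top"
    by (intro tendsto_intros lims)
  show "\<forall>\<^sub>F t in at_top. (1 + exp (- (v / w)) ^ 4) *
      (((r t + w) * p + (s t + v) * q)\<^sup>2 + (w21 t * p + (r t + w) * q)\<^sup>2)
    \<le> ((r t + w)\<^sup>2 + (s t + v)\<^sup>2 + (w21 t)\<^sup>2 + (r t + w)\<^sup>2) * (p\<^sup>2 + q\<^sup>2)"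
    using eventually_ge_at_top[of T] by eventually_elim (rule spectral_ineq)
qed simp

end

section \<open>Reduction of the gradient flow\<close>

text \<open>A bound tested on vectors replaces the computation of the spectral norm. The condition
  \<open>W \<noteq> 0\<close> keeps the denominator positive; for \<open>W = 0\<close> the quotient
  would be 0 by convention.\<close>

lemma stable_rank_ge:
  fixes W :: "real ^ 'n ^ 'm"
  assumes "0 < c" and "W \<noteq> 0"
    and *: "\<And>p. c * (norm (W *v p))\<^sup>2 \<le> (norm W)\<^sup>2 * (norm p)\<^sup>2"
  shows "c \<le> stable_rank W"
proof -
  have "onorm ((*v) W) \<le> norm W / sqrt c"
  proof (rule onorm_bound)
    fix p
    have "(sqrt c * norm (W *v p))\<^sup>2 \<le> (norm W * norm p)\<^sup>2"
      using *[of p] \<open>0 < c\<close> by (simp add: power_mult_distrib)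
    hence "sqrt c * norm (W *v p) \<le> norm W * norm p"
      by (rule power2_le_imp_le) simp
    thus "norm (W *v p) \<le> norm W / sqrt c * norm p"
      using \<open>0 < c\<close> by (simp add: field_simps)
  qed (use \<open>0 < c\<close> in simp)
  hence "(onorm ((*v) W))\<^sup>2 \<le> (norm W / sqrt c)\<^sup>2"
    by (intro power_mono onorm_pos_le matrix_vector_mul_bounded_linear)
  hence "c * (onorm ((*v) W))\<^sup>2 \<le> (norm W)\<^sup>2"
    using \<open>0 < c\<close> by (simp add: power_divide field_simps)
  moreover have "0 < onorm ((*v) W)"
    using \<open>W \<noteq> 0\<close> by (subst onorm_pos_lt[OF matrix_vector_mul_bounded_linear]) (auto simp: matrix_eq)
  ultimately show ?thesis
    unfolding stable_rank_def by (subst pos_le_divide_eq) auto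
qed

text \<open>By uniqueness of the derivative, \<open>inner H G\<close> is the directional derivative
  computed by hand; taking matrix units for \<open>H\<close> extracts the entries of
  \<open>G\<close>. The second row sees only the residual at (2,2), because (2,1) is
  unobserved.\<close>

lemma GDERIV_loss_post_left:
  fixes A B :: "real ^ 2 ^ 2"
  assumes "GDERIV (\<lambda>X. loss_post ws w12 (X ** B)) A :> G"
  defines "W \<equiv> A ** B"
  shows "G $ 1 $ j = (W $ 1 $ 1 - ws) * B $ j $ 1 + (W $ 1 $ 2 - w12) * B $ j $ 2"
        "G $ 2 $ j = (W $ 2 $ 2 - ws) * B $ j $ 2"
proof -
  have entry: "((\<lambda>X. (X ** B) $ i $ j) has_derivative (\<lambda>H. (H ** B) $ i $ j)) (at A)" for i j
    unfolding matrix_matrix_mult_def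
    by (auto intro!: derivative_eq_intros bounded_linear.has_derivative[OF bounded_linear_vec_nth])
  have "((\<lambda>X. loss_post ws w12 (X ** B)) has_derivative
     (\<lambda>H. (W $ 1 $ 1 - ws) * (H ** B) $ 1 $ 1 + (W $ 1 $ 2 - w12) * (H ** B) $ 1 $ 2
        + (W $ 2 $ 2 - ws) * (H ** B) $ 2 $ 2)) (at A)"
    unfolding loss_post_def W_def
    by (auto intro!: derivative_eq_intros entry simp: fun_eq_iff algebra_simps diff_divide_distrib)
  from has_derivative_unique[OF this assms(1)[unfolded gderiv_def]]
  have *: "inner H G = (W $ 1 $ 1 - ws) * (H ** B) $ 1 $ 1 + (W $ 1 $ 2 - w12) * (H ** B) $ 1 $ 2
        + (W $ 2 $ 2 - ws) * (H ** B) $ 2 $ 2" for H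
    by (simp add: fun_eq_iff)
  have **: "inner (axis i (axis j 1)) G = G $ i $ j" for i j
    by (simp add: inner_axis' )
  show "G $ 1 $ j = (W $ 1 $ 1 - ws) * B $ j $ 1 + (W $ 1 $ 2 - w12) * B $ j $ 2"
       "G $ 2 $ j = (W $ 2 $ 2 - ws) * B $ j $ 2"
    unfolding **[symmetric] * matrix_matrix_mult_def using exhaust_2[of j] by (auto simp: sum_2 axis_def)
qed

lemma GDERIV_loss_post_right:
  fixes A B :: "real ^ 2 ^ 2"
  assumes "GDERIV (\<lambda>X. loss_post ws w12 (A ** X)) B :> G"
  defines "W \<equiv> A ** B"
  shows "G $ i $ 1 = (W $ 1 $ 1 - ws) * A $ 1 $ i"
        "G $ i $ 2 = (W $ 1 $ 2 - w12) * A $ 1 $ i + (W $ 2 $ 2 - ws) * A $ 2 $ i"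
proof -
  have entry: "((\<lambda>X. (A ** X) $ i $ j) has_derivative (\<lambda>H. (A ** H) $ i $ j)) (at B)" for i j
    unfolding matrix_matrix_mult_def
    by (auto intro!: derivative_eq_intros bounded_linear.has_derivative[OF bounded_linear_vec_nth])
  have "((\<lambda>X. loss_post ws w12 (A ** X)) has_derivative
     (\<lambda>H. (W $ 1 $ 1 - ws) * (A ** H) $ 1 $ 1 + (W $ 1 $ 2 - w12) * (A ** H) $ 1 $ 2
        + (W $ 2 $ 2 - ws) * (A ** H) $ 2 $ 2)) (at B)"
    unfolding loss_post_def W_def
    by (auto intro!: derivative_eq_intros entry simp: fun_eq_iff algebra_simps diff_divide_distrib)
  from has_derivative_unique[OF this assms(1)[unfolded gderiv_def]]
  have *: "inner H G = (W $ 1 $ 1 - ws) * (A ** H) $ 1 $ 1 + (W $ 1 $ 2 - w12) * (A ** H) $ 1 $ 2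
        + (W $ 2 $ 2 - ws) * (A ** H) $ 2 $ 2" for H
    by (simp add: fun_eq_iff)
  have **: "inner (axis i (axis j 1)) G = G $ i $ j" for i j
    by (simp add: inner_axis')
  show "G $ i $ 1 = (W $ 1 $ 1 - ws) * A $ 1 $ i"
       "G $ i $ 2 = (W $ 1 $ 2 - w12) * A $ 1 $ i + (W $ 2 $ 2 - ws) * A $ 2 $ i"
    unfolding **[symmetric] * matrix_matrix_mult_def using exhaust_2[of i] by (auto simp: sum_2 axis_def)
qed

section \<open>The flow in matrix entries and its symmetry\<close>

locale diagonal_start_flow =
  fixes w v T :: real and A B :: "real \<Rightarrow> real ^ 2 ^ 2"
  assumes w_pos: "0 < w" and v_pos: "0 < v"
    and init: "A T = sqrt w *\<^sub>R mat 1" "B T = sqrt w *\<^sub>R mat 1"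
    and flow: "factor_gradient_flow (loss_post w v) T A B"
begin

definition r1 :: "real \<Rightarrow> real" where "r1 t = (A t ** B t) $ 1 $ 1 - w"
definition r2 :: "real \<Rightarrow> real" where "r2 t = (A t ** B t) $ 2 $ 2 - w"
definition s :: "real \<Rightarrow> real" where "s t = (A t ** B t) $ 1 $ 2 - v"

lemma entry_derivs:
  assumes "T \<le> t"
  shows "((\<lambda>t. A t $ 1 $ j) has_real_derivative - (r1 t * B t $ j $ 1 + s t * B t $ j $ 2)) (at t within {T..})"
    and "((\<lambda>t. A t $ 2 $ j) has_real_derivative - (r2 t * B t $ j $ 2)) (at t within {T..})"
    and "((\<lambda>t. B t $ j $ 1) has_real_derivative - (r1 t * A t $ 1 $ j)) (at t within {T..})"
    and "((\<lambda>t. B t $ j $ 2) has_real_derivative - (s t * A t $ 1 $ j + r2 t * A t $ 2 $ j)) (at t within {T..})"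
proof -
  obtain GA GB where G:
    "GDERIV (\<lambda>X. loss_post w v (X ** B t)) (A t) :> GA"
    "GDERIV (\<lambda>Y. loss_post w v (A t ** Y)) (B t) :> GB"
    "(A has_vector_derivative - GA) (at t within {T..})"
    "(B has_vector_derivative - GB) (at t within {T..})"
    using flow assms unfolding factor_gradient_flow_def by blast
  have entry: "((\<lambda>t. M t $ i $ j) has_real_derivative - (G $ i $ j)) (at t within {T..})"
    if "(M has_vector_derivative - G) (at t within {T..})" for M :: "real \<Rightarrow> real ^ 2 ^ 2" and G i j
    using bounded_linear.has_vector_derivative[OF bounded_linear_vec_nth
        bounded_linear.has_vector_derivative[OF bounded_linear_vec_nth that]]
    by (simp add: has_real_derivative_iff_has_vector_derivative)
  note gd = GDERIV_loss_post_left[OF G(1)] GDERIV_loss_post_right[OF G(2)]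
  show "((\<lambda>t. A t $ 1 $ j) has_real_derivative - (r1 t * B t $ j $ 1 + s t * B t $ j $ 2)) (at t within {T..})"
    "((\<lambda>t. A t $ 2 $ j) has_real_derivative - (r2 t * B t $ j $ 2)) (at t within {T..})"
    "((\<lambda>t. B t $ j $ 1) has_real_derivative - (r1 t * A t $ 1 $ j)) (at t within {T..})"
    "((\<lambda>t. B t $ j $ 2) has_real_derivative - (s t * A t $ 1 $ j + r2 t * A t $ 2 $ j)) (at t within {T..})"
    using entry[OF G(3), of 1 j] entry[OF G(3), of 2 j] entry[OF G(4), of j 1] entry[OF G(4), of j 2]
    unfolding gd r1_def r2_def s_def by simp_all
qed

lemma continuous_entries: "continuous_on {T..} (\<lambda>t. A t $ i $ j)" "continuous_on {T..} (\<lambda>t. B t $ i $ j)"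
proof -
  have "continuous_on {T..} (\<lambda>t. A t $ 1 $ j)" "continuous_on {T..} (\<lambda>t. A t $ 2 $ j)"
       "continuous_on {T..} (\<lambda>t. B t $ i $ 1)" "continuous_on {T..} (\<lambda>t. B t $ i $ 2)"
    by (rule DERIV_continuous_on, rule entry_derivs, simp)+
  thus "continuous_on {T..} (\<lambda>t. A t $ i $ j)" "continuous_on {T..} (\<lambda>t. B t $ i $ j)"
    using exhaust_2[of i] exhaust_2[of j] by auto
qed

lemma product_entry: "(A t ** B t) $ i $ j = A t $ i $ 1 * B t $ 1 $ j + A t $ i $ 2 * B t $ 2 $ j"
  by (simp add: matrix_matrix_mult_def sum_2)

lemma continuous_residuals: "continuous_on {T..} r1" "continuous_on {T..} r2" "continuous_on {T..} s"
  unfolding r1_def[abs_def] r2_def[abs_def] s_def[abs_def] product_entry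
  by (intro continuous_intros continuous_entries)+

text \<open>Reflecting both factors in the antidiagonal and swapping them preserves the loss and the
  initial state. The difference of the flow and its reflected copy solves a linear equation.\<close>
lemma symmetric:
  assumes "T \<le> t"
  shows "B t $ 2 $ 2 = A t $ 1 $ 1" "B t $ 1 $ 2 = A t $ 1 $ 2"
    and "B t $ 2 $ 1 = A t $ 2 $ 1" "B t $ 1 $ 1 = A t $ 2 $ 2"
proof -
  define f where "f i t = [A t $ 1 $ 1 - B t $ 2 $ 2, A t $ 1 $ 2 - B t $ 1 $ 2,
    A t $ 2 $ 1 - B t $ 2 $ 1, A t $ 2 $ 2 - B t $ 1 $ 1] ! i" for i t
  \<comment> \<open>The coefficients depend on the flow itself, but only their continuity in
    \<open>t\<close> matters. The rows come from eliminating \<open>r1\<close>, since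
    \<open>r1 - r2\<close> is itself linear in the differences \<open>f\<close>.\<close>
  define c where "c i j t =
    [[- B t $ 1 $ 1 * B t $ 1 $ 1, s t - B t $ 2 $ 1 * B t $ 1 $ 1, B t $ 1 $ 2 * B t $ 1 $ 1, r2 t + B t $ 2 $ 2 * B t $ 1 $ 1],
     [s t - B t $ 1 $ 1 * B t $ 2 $ 1, - B t $ 2 $ 1 * B t $ 2 $ 1, r2 t + B t $ 1 $ 2 * B t $ 2 $ 1, B t $ 2 $ 2 * B t $ 2 $ 1],
     [B t $ 1 $ 1 * A t $ 1 $ 2, r2 t + B t $ 2 $ 1 * A t $ 1 $ 2, - B t $ 1 $ 2 * A t $ 1 $ 2, - B t $ 2 $ 2 * A t $ 1 $ 2],
     [r2 t + B t $ 1 $ 1 * A t $ 1 $ 1, B t $ 2 $ 1 * A t $ 1 $ 1, - B t $ 1 $ 2 * A t $ 1 $ 1, - B t $ 2 $ 2 * A t $ 1 $ 1]] ! i ! j"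
    for i j t
  define I where "I = {0, 1, 2, 3 :: nat}"
  have zero: "f i t = 0" if "i \<in> I" for i
  proof (rule linear_ode_unique_zero[OF _ that assms])
    fix i t assume "i \<in> I" "T \<le> t"
    have r1: "r1 t = r2 t - (- B t $ 1 $ 1 * f 0 t - B t $ 2 $ 1 * f 1 t + B t $ 1 $ 2 * f 2 t + B t $ 2 $ 2 * f 3 t)"
      by (simp add: r1_def r2_def product_entry f_def algebra_simps)
    have "(f 0 has_real_derivative (\<Sum>j\<in>I. c 0 j t * f j t)) (at t within {T..})"
         "(f 1 has_real_derivative (\<Sum>j\<in>I. c 1 j t * f j t)) (at t within {T..})"
         "(f 2 has_real_derivative (\<Sum>j\<in>I. c 2 j t * f j t)) (at t within {T..})"
         "(f 3 has_real_derivative (\<Sum>j\<in>I. c 3 j t * f j t)) (at t within {T..})"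
      unfolding f_def[abs_def] using \<open>T \<le> t\<close>
      by (auto intro!: derivative_eq_intros entry_derivs simp: I_def c_def r1 f_def algebra_simps)
    thus "(f i has_real_derivative (\<Sum>j\<in>I. c i j t * f j t)) (at t within {T..})"
      using \<open>i \<in> I\<close> unfolding I_def by blast
  next
    fix i j assume "i \<in> I" "j \<in> I"
    thus "continuous_on {T..} (c i j)"
      unfolding c_def[abs_def] I_def
      by (auto intro!: continuous_intros continuous_entries continuous_residuals)
  next
    fix i assume "i \<in> I"
    thus "f i T = 0"
      by (auto simp: I_def f_def init mat_def)
  qed (simp add: I_def)
  show "B t $ 2 $ 2 = A t $ 1 $ 1" "B t $ 1 $ 2 = A t $ 1 $ 2" "B t $ 2 $ 1 = A t $ 2 $ 1" "B t $ 1 $ 1 = A t $ 2 $ 2"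
    using zero[of 0] zero[of 1] zero[of 2] zero[of 3] by (auto simp: I_def f_def)
qed

section \<open>Passage to the reduced coordinates\<close>

definition x :: "real \<Rightarrow> real" where "x t = A t $ 1 $ 1 + A t $ 1 $ 2"
definition z :: "real \<Rightarrow> real" where "z t = A t $ 2 $ 1 + A t $ 2 $ 2"
definition k :: "real \<Rightarrow> real" where "k t = exp (integral {T..t} s)"

lemma r2_eq_r1: "T \<le> t \<Longrightarrow> r2 t = r1 t"
  by (simp add: r1_def r2_def product_entry symmetric algebra_simps)

lemma x_deriv: "T \<le> t \<Longrightarrow> (x has_real_derivative - (r1 t * z t + s t * x t)) (at t within {T..})"
  unfolding x_def[abs_def] z_def
  by (auto intro!: derivative_eq_intros entry_derivs simp: symmetric algebra_simps)

lemma z_deriv: "T \<le> t \<Longrightarrow> (z has_real_derivative - (r1 t * x t)) (at t within {T..})"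
  unfolding z_def[abs_def] x_def
  by (auto intro!: derivative_eq_intros entry_derivs simp: symmetric r2_eq_r1 algebra_simps)

lemma k_deriv:
  assumes "T \<le> t"
  shows "(k has_real_derivative s t * k t) (at t within {T..})"
proof -
  \<comment> \<open>The interval extends beyond \<open>t\<close>, so near \<open>t\<close> it agrees
    with \<open>{T..}\<close> and the derivative carries over.\<close>
  have "((\<lambda>t. integral {T..t} s) has_real_derivative s t) (at t within {T..t + 1})"
    by (intro integral_has_real_derivative continuous_on_subset[OF continuous_residuals(3)])
       (use assms in auto)
  moreover have "at t within {T..t + 1} = at t within {T..}"
    by (rule at_within_nhd[of _ "{..<t + 1}"]) auto
  ultimately show ?thesis
    unfolding k_def[abs_def] by (auto intro!: derivative_eq_intros)
qed

text \<open>The pair \<open>(u - k x, y - k z)\<close> solves a linear equation with zero initial value.\<close>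
lemma scaled:
  assumes "T \<le> t"
  shows "A t $ 2 $ 2 - A t $ 2 $ 1 = k t * x t" "A t $ 1 $ 1 - A t $ 1 $ 2 = k t * z t"
proof -
  define f where "f i t = [A t $ 2 $ 2 - A t $ 2 $ 1 - k t * x t, A t $ 1 $ 1 - A t $ 1 $ 2 - k t * z t] ! i" for i t
  define c where "c i j t = [[0, - r1 t], [- r1 t, s t]] ! i ! j" for i j t
  define I where "I = {0, 1 :: nat}"
  have zero: "f i t = 0" if "i \<in> I" for i
  proof (rule linear_ode_unique_zero[OF _ that assms])
    fix i t assume "i \<in> I" "T \<le> t"
    have "(f 0 has_real_derivative (\<Sum>j\<in>I. c 0 j t * f j t)) (at t within {T..})"
         "(f 1 has_real_derivative (\<Sum>j\<in>I. c 1 j t * f j t)) (at t within {T..})"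
      unfolding f_def[abs_def] using \<open>T \<le> t\<close>
      by (auto intro!: derivative_eq_intros entry_derivs x_deriv z_deriv k_deriv
          simp: I_def c_def f_def symmetric r2_eq_r1 algebra_simps)
    thus "(f i has_real_derivative (\<Sum>j\<in>I. c i j t * f j t)) (at t within {T..})"
      using \<open>i \<in> I\<close> unfolding I_def by blast
  next
    fix i j assume "i \<in> I" "j \<in> I"
    thus "continuous_on {T..} (c i j)"
      unfolding c_def[abs_def] I_def
      by (auto intro!: continuous_intros continuous_residuals)
  next
    fix i assume "i \<in> I"
    thus "f i T = 0"
      by (auto simp: I_def f_def init mat_def x_def z_def k_def)
  qed (simp add: I_def)
  show "A t $ 2 $ 2 - A t $ 2 $ 1 = k t * x t" "A t $ 1 $ 1 - A t $ 1 $ 2 = k t * z t"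
    using zero[of 0] zero[of 1] by (auto simp: I_def f_def)
qed

lemma A_entries:
  assumes "T \<le> t"
  shows "A t $ 1 $ 1 = (x t + k t * z t) / 2" "A t $ 1 $ 2 = (x t - k t * z t) / 2"
    and "A t $ 2 $ 1 = (z t - k t * x t) / 2" "A t $ 2 $ 2 = (z t + k t * x t) / 2"
  using scaled[OF assms] by (auto simp: x_def z_def)

text \<open>The residuals \<open>r1\<close> and \<open>s\<close> match these formulas only from time
  \<open>T\<close> on, whereas \<open>reduced_flow\<close> demands them at all times.\<close>

definition r_red :: "real \<Rightarrow> real" where "r_red t = x t * z t * (1 + (k t)\<^sup>2) / 2 - w"
definition s_red :: "real \<Rightarrow> real" where "s_red t = ((x t)\<^sup>2 - (k t)\<^sup>2 * (z t)\<^sup>2) / 2 - v"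

lemma residuals_eq:
  assumes "T \<le> t"
  shows "r1 t = r_red t" "s t = s_red t"
  unfolding r1_def r_red_def s_def s_red_def product_entry symmetric[OF assms] A_entries[OF assms]
  by (simp_all add: field_simps power2_eq_square)

sublocale reduced_flow w v T x z k r_red s_red
proof
  fix t assume "T \<le> t"
  thus "(x has_real_derivative - (r_red t * z t + s_red t * x t)) (at t within {T..})"
    "(z has_real_derivative - (r_red t * x t)) (at t within {T..})"
    "(k has_real_derivative s_red t * k t) (at t within {T..})"
    using x_deriv z_deriv k_deriv by (simp_all flip: residuals_eq)
qed (simp_all add: w_pos v_pos k_def r_red_def s_red_def x_def z_def init mat_def)

section \<open>The limit matrix and its stable rank\<close>

lemma product_entries:
  assumes "T \<le> t"
  shows "(A t ** B t) $ 1 $ 1 = r_red t + w" "(A t ** B t) $ 2 $ 2 = r_red t + w"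
    and "(A t ** B t) $ 1 $ 2 = s_red t + v" "(A t ** B t) $ 2 $ 1 = w21 t"
  using residuals_eq[OF assms] r2_eq_r1[OF assms]
  by (simp_all add: r1_def r2_def s_def)
     (simp add: w21_def product_entry symmetric[OF assms] A_entries[OF assms] field_simps power2_eq_square)

lemma product_limit:
  assumes "(w21 \<longlongrightarrow> l) at_top"
  defines "W \<equiv> vector [vector [w, v], vector [l, w]] :: real ^ 2 ^ 2"
  shows "((\<lambda>t. A t ** B t) \<longlongrightarrow> W) at_top"
proof (intro vec_tendstoI)
  fix i j :: 2
  have "((\<lambda>t. r_red t + w) \<longlongrightarrow> 0 + w) at_top" "((\<lambda>t. s_red t + v) \<longlongrightarrow> 0 + v) at_top"
    by (intro tendsto_intros r_s_tendsto_0)+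
  hence "((\<lambda>t. (A t ** B t) $ 1 $ 1) \<longlongrightarrow> w) at_top" "((\<lambda>t. (A t ** B t) $ 2 $ 2) \<longlongrightarrow> w) at_top"
    "((\<lambda>t. (A t ** B t) $ 1 $ 2) \<longlongrightarrow> v) at_top" "((\<lambda>t. (A t ** B t) $ 2 $ 1) \<longlongrightarrow> l) at_top"
    using assms(1) by (auto elim!: Lim_transform_eventually intro!: eventually_at_top_linorderI[of T] simp: product_entries)
  thus "((\<lambda>t. (A t ** B t) $ i $ j) \<longlongrightarrow> W $ i $ j) at_top"
    using exhaust_2[of i] exhaust_2[of j] by (auto simp: W_def)
qed

lemma stable_rank_limit:
  assumes "(w21 \<longlongrightarrow> l) at_top"
  defines "W \<equiv> vector [vector [w, v], vector [l, w]] :: real ^ 2 ^ 2"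
  shows "1 + exp (- (v / w)) ^ 4 \<le> stable_rank W"
proof (rule stable_rank_ge)
  have "W $ 1 $ 1 \<noteq> 0"
    using w_pos by (simp add: W_def)
  thus "W \<noteq> 0"
    by auto
  fix p :: "real ^ 2"
  show "(1 + exp (- (v / w)) ^ 4) * (norm (W *v p))\<^sup>2 \<le> (norm W)\<^sup>2 * (norm p)\<^sup>2"
    using spectral_ineq_limit[OF assms(1), of "p $ 1" "p $ 2"]
    by (simp add: power2_norm_eq_inner inner_vec_def sum_2 matrix_vector_mult_def W_def flip: power2_eq_square)
qed (simp add: add_pos_pos)

end

theorem theorem4p2:
  fixes ws w12 T1 :: real
    and A B :: "real \<Rightarrow> real ^ 2 ^ 2"
  assumes "ws > 0" and "w12 > 0" and "T1 \<ge> 0"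
    and "A T1 = sqrt ws *\<^sub>R mat 1" and "B T1 = sqrt ws *\<^sub>R mat 1"
    and "factor_gradient_flow (loss_post ws w12) T1 A B"
  shows "(\<forall>t\<ge>T1. loss_post ws w12 (A t ** B t) \<le> 1 / 2 * w12\<^sup>2 * exp (- 2 * ws * (t - T1))) \<and>
         (\<exists>Winf. ((\<lambda>t. A t ** B t) \<longlongrightarrow> Winf) at_top \<and>
                 stable_rank Winf \<ge> 1 + exp (- 8 * (w12 / ws))) \<and>
         (\<forall>t>T1. (A t ** B t) $ 2 $ 1 < 0)"
proof -
  interpret diagonal_start_flow ws w12 T1 A B
    by standard (use assms in auto)
  have "loss_post ws w12 (A t ** B t) \<le> 1 / 2 * w12\<^sup>2 * exp (- 2 * ws * (t - T1))" if "T1 \<le> t" for t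
    using loss_bound[OF that] by (simp add: loss_post_def product_entries[OF that])
  moreover have "(A t ** B t) $ 2 $ 1 < 0" if "T1 < t" for t
    using w21_neg[OF that] that by (simp add: product_entries)
  moreover obtain l where l: "(w21 \<longlongrightarrow> l) at_top"
    using w21_convergent by blast
  \<comment> \<open>The argument gives the exponent \<open>- 4 * (w12 / ws)\<close>, which is larger
    than the one claimed because \<open>w12 / ws\<close> is positive.\<close>
  moreover have "exp (- 8 * (w12 / ws)) \<le> exp (- (w12 / ws)) ^ 4"
    using assms(1,2) by (simp add: divide_right_mono flip: exp_of_nat_mult)
  ultimately show ?thesis
    using product_limit[OF l] stable_rank_limit[OF l] by (smt (verit, best))
qed

end
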